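(* Let $W$ be a finite Coxeter group and $M=M(W)$ its biHecke monoid. The idempotents $(e_w)_{w\in W}$, where $e_w=\pi_{w^{-1}w_0}\,\overline\pi_{w_0w}$, form a complete set of representatives of the conjugacy classes of idempotents in $M$.
   Context: $W$ is a finite Coxeter group with simple reflections $(s_i)_{i\in I}$, longest element $w_0$, length $\ell$; $D_R(w)=\{i:\ell(ws_i)<\ell(w)\}$. The biHecke monoid $M(W)$ is the monoid of functions $W\to W$, acting on the right ($w.(fg)=(w.f).g$), generated by $\pi_i,\overline\pi_i$ ($i\in I$), where $w.\pi_i=w$ if $i\in D_R(w)$ and $ws_i$ otherwise; $w.\overline\pi_i=ws_i$ if $i\in D_R(w)$ and $w$ otherwise. For $v\in W$ with reduced word $i_1\cdots i_k$, $\pi_v=\pi_{i_1}\cdots\pi_{i_k}$ and $\overline\pi_v=\overline\pi_{i_1}\cdots\overline\pi_{i_k}$ (independent of the reduced word). Two idempotents $e,f$ of $M$ are conjugate if $MeM=MfM$ (i.e. $f\in MeM$ and $e\in MfM$). *)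

theory Defs
  imports "HOL-Algebra.Group"
begin

definition word_prod :: "('a, 'b) monoid_scheme \<Rightarrow> ('i \<Rightarrow> 'a) \<Rightarrow> 'i list \<Rightarrow> 'a" where
  "word_prod G f u = foldr (\<lambda>i x. f i \<otimes>\<^bsub>G\<^esub> x) u \<one>\<^bsub>G\<^esub>"

section \<open>Coxeter systems\<close>

text \<open>The entry \<open>0\<close> encodes \<open>\<infinity>\<close> (no relation between \<open>i\<close> and \<open>j\<close>), so off-diagonal
  entries are \<open>0\<close> or at least \<open>2\<close>.\<close>

definition coxeter_matrix :: "'i set \<Rightarrow> ('i \<Rightarrow> 'i \<Rightarrow> nat) \<Rightarrow> bool" where
  "coxeter_matrix I m \<longleftrightarrow>
     (\<forall>i\<in>I. m i i = 1) \<and> (\<forall>i\<in>I. \<forall>j\<in>I. i \<noteq> j \<longrightarrow> m i j = m j i \<and> m i j \<noteq> 1)"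

text \<open>The congruence on words over \<open>I\<close> generated by the relations \<open>(i j)^m(i,j) = 1\<close>.  Since
  \<open>m(i,i) = 1\<close> makes every letter its own inverse, formal inverses are not needed, and the
  quotient of the free monoid by this congruence is the group with this presentation.\<close>

inductive coxeter_cong :: "'i set \<Rightarrow> ('i \<Rightarrow> 'i \<Rightarrow> nat) \<Rightarrow> 'i list \<Rightarrow> 'i list \<Rightarrow> bool"
  for I :: "'i set" and m :: "'i \<Rightarrow> 'i \<Rightarrow> nat" where
  relation: "i \<in> I \<Longrightarrow> j \<in> I \<Longrightarrow> coxeter_cong I m (concat (replicate (m i j) [i, j])) []"
| refl: "u \<in> lists I \<Longrightarrow> coxeter_cong I m u u"
| sym: "coxeter_cong I m u v \<Longrightarrow> coxeter_cong I m v u"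
| trans: "coxeter_cong I m u v \<Longrightarrow> coxeter_cong I m v w \<Longrightarrow> coxeter_cong I m u w"
| append: "coxeter_cong I m u u' \<Longrightarrow> coxeter_cong I m v v' \<Longrightarrow> coxeter_cong I m (u @ v) (u' @ v')"

text \<open>\<open>W\<close> is presented by the generators \<open>s i\<close>, \<open>i \<in> I\<close>, and the relations of some Coxeter
  matrix: the \<open>s i\<close> generate \<open>W\<close> and satisfy exactly the consequences of these relations.\<close>

definition coxeter_system :: "('a, 'b) monoid_scheme \<Rightarrow> 'i set \<Rightarrow> ('i \<Rightarrow> 'a) \<Rightarrow> bool" where
  "coxeter_system W I s \<longleftrightarrow>
     group W \<and> s \<in> I \<rightarrow> carrier W \<and>
     word_prod W s ` lists I = carrier W \<and>
     (\<exists>m. coxeter_matrix I m \<and>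
        (\<forall>u\<in>lists I. \<forall>v\<in>lists I. word_prod W s u = word_prod W s v \<longleftrightarrow> coxeter_cong I m u v))"

definition cox_length :: "('a, 'b) monoid_scheme \<Rightarrow> 'i set \<Rightarrow> ('i \<Rightarrow> 'a) \<Rightarrow> 'a \<Rightarrow> nat" where
  "cox_length W I s w = (LEAST n. \<exists>u\<in>lists I. word_prod W s u = w \<and> length u = n)"

definition is_reduced_word ::
    "('a, 'b) monoid_scheme \<Rightarrow> 'i set \<Rightarrow> ('i \<Rightarrow> 'a) \<Rightarrow> 'i list \<Rightarrow> 'a \<Rightarrow> bool" where
  "is_reduced_word W I s u w \<longleftrightarrow>
     u \<in> lists I \<and> word_prod W s u = w \<and> length u = cox_length W I s w"

definition longest_element :: "('a, 'b) monoid_scheme \<Rightarrow> 'i set \<Rightarrow> ('i \<Rightarrow> 'a) \<Rightarrow> 'a" where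
  "longest_element W I s = (ARG_MAX (cox_length W I s) w. w \<in> carrier W)"

definition right_descents ::
    "('a, 'b) monoid_scheme \<Rightarrow> 'i set \<Rightarrow> ('i \<Rightarrow> 'a) \<Rightarrow> 'a \<Rightarrow> 'i set" where
  "right_descents W I s w =
     {i \<in> I. cox_length W I s (w \<otimes>\<^bsub>W\<^esub> s i) < cox_length W I s w}"

section \<open>Monoids of functions acting on the right\<close>

text \<open>Functions \<open>A \<rightarrow> A\<close> are taken extensional, so that they are equal iff they agree on \<open>A\<close>.
  The action is on the right: in the product \<open>f \<otimes> g\<close>, first \<open>f\<close> is applied, then \<open>g\<close>.\<close>

definition transformation_monoid :: "'a set \<Rightarrow> ('a \<Rightarrow> 'a) monoid" where
  "transformation_monoid A =
     \<lparr>carrier = A \<rightarrow>\<^sub>E A, mult = (\<lambda>f g. compose A g f), one = (\<lambda>x\<in>A. x)\<rparr>"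

inductive_set submonoid_generated :: "('a, 'b) monoid_scheme \<Rightarrow> 'a set \<Rightarrow> 'a set"
  for T :: "('a, 'b) monoid_scheme" and X :: "'a set" where
  one: "\<one>\<^bsub>T\<^esub> \<in> submonoid_generated T X"
| incl: "x \<in> X \<Longrightarrow> x \<in> submonoid_generated T X"
| mult: "x \<in> submonoid_generated T X \<Longrightarrow> y \<in> submonoid_generated T X \<Longrightarrow>
    x \<otimes>\<^bsub>T\<^esub> y \<in> submonoid_generated T X"

definition idempotents :: "('a, 'b) monoid_scheme \<Rightarrow> 'a set" where
  "idempotents M = {e \<in> carrier M. e \<otimes>\<^bsub>M\<^esub> e = e}"

definition two_sided_ideal :: "('a, 'b) monoid_scheme \<Rightarrow> 'a \<Rightarrow> 'a set" where
  "two_sided_ideal M e =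
     {a \<otimes>\<^bsub>M\<^esub> e \<otimes>\<^bsub>M\<^esub> b | a b. a \<in> carrier M \<and> b \<in> carrier M}"

definition conjugate_idempotents :: "('a, 'b) monoid_scheme \<Rightarrow> 'a \<Rightarrow> 'a \<Rightarrow> bool" where
  "conjugate_idempotents M e f \<longleftrightarrow>
     e \<in> idempotents M \<and> f \<in> idempotents M \<and> two_sided_ideal M e = two_sided_ideal M f"

section \<open>The biHecke monoid\<close>

definition hecke_pi ::
    "('a, 'b) monoid_scheme \<Rightarrow> 'i set \<Rightarrow> ('i \<Rightarrow> 'a) \<Rightarrow> 'i \<Rightarrow> 'a \<Rightarrow> 'a" where
  "hecke_pi W I s i =
     (\<lambda>w\<in>carrier W. if i \<in> right_descents W I s w then w else w \<otimes>\<^bsub>W\<^esub> s i)"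

definition hecke_pi_bar ::
    "('a, 'b) monoid_scheme \<Rightarrow> 'i set \<Rightarrow> ('i \<Rightarrow> 'a) \<Rightarrow> 'i \<Rightarrow> 'a \<Rightarrow> 'a" where
  "hecke_pi_bar W I s i =
     (\<lambda>w\<in>carrier W. if i \<in> right_descents W I s w then w \<otimes>\<^bsub>W\<^esub> s i else w)"

definition biHecke_monoid ::
    "('a, 'b) monoid_scheme \<Rightarrow> 'i set \<Rightarrow> ('i \<Rightarrow> 'a) \<Rightarrow> ('a \<Rightarrow> 'a) monoid" where
  "biHecke_monoid W I s =
     (let T = transformation_monoid (carrier W)
      in T\<lparr>carrier := submonoid_generated T (hecke_pi W I s ` I \<union> hecke_pi_bar W I s ` I)\<rparr>)"

text \<open>The products below do not depend on the reduced word (braid relations), so an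
  arbitrary one is chosen.\<close>

definition some_reduced_word ::
    "('a, 'b) monoid_scheme \<Rightarrow> 'i set \<Rightarrow> ('i \<Rightarrow> 'a) \<Rightarrow> 'a \<Rightarrow> 'i list" where
  "some_reduced_word W I s v = (SOME u. is_reduced_word W I s u v)"

definition pi_elt ::
    "('a, 'b) monoid_scheme \<Rightarrow> 'i set \<Rightarrow> ('i \<Rightarrow> 'a) \<Rightarrow> 'a \<Rightarrow> 'a \<Rightarrow> 'a" where
  "pi_elt W I s v = word_prod (biHecke_monoid W I s) (hecke_pi W I s) (some_reduced_word W I s v)"

definition pi_bar_elt ::
    "('a, 'b) monoid_scheme \<Rightarrow> 'i set \<Rightarrow> ('i \<Rightarrow> 'a) \<Rightarrow> 'a \<Rightarrow> 'a \<Rightarrow> 'a" where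
  "pi_bar_elt W I s v =
     word_prod (biHecke_monoid W I s) (hecke_pi_bar W I s) (some_reduced_word W I s v)"

definition biHecke_idem ::
    "('a, 'b) monoid_scheme \<Rightarrow> 'i set \<Rightarrow> ('i \<Rightarrow> 'a) \<Rightarrow> 'a \<Rightarrow> 'a \<Rightarrow> 'a" where
  "biHecke_idem W I s w =
     pi_elt W I s (inv\<^bsub>W\<^esub> w \<otimes>\<^bsub>W\<^esub> longest_element W I s)
       \<otimes>\<^bsub>biHecke_monoid W I s\<^esub>
     pi_bar_elt W I s (longest_element W I s \<otimes>\<^bsub>W\<^esub> w)"

end

theory Submission
  imports Defs "HOL-Library.Sublist"
begin

text \<open>
  Everything follows from how \<open>M\<close> acts on the left weak order, in which \<open>x \<le> z\<close> means that
  \<open>z = u x\<close> with lengths adding up. Left multiplication commutes with right multiplication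
  by a generator, so an element of \<open>M\<close> carries a covering pair \<open>w < s\<^sub>j w\<close> to a covering
  pair with the same label \<open>j\<close>, unless it contracts it (\<open>M_cover\<close>). Consequently, when \<open>u x\<close> lies
  above \<open>x\<close>, its image lies above the image of \<open>x\<close> by a subword of \<open>u\<close> (\<open>M_subword\<close>). In
  particular the action is monotone, and a chain that does not become shorter keeps all its labels.

  The first factor of \<open>e w\<close> translates the interval \<open>[1, w]\<close> on the right to \<open>[w\<inverse>w\<^sub>0, w\<^sub>0]\<close> and
  the second one translates it back; moreover \<open>e w\<close> sends \<open>w\<^sub>0\<close> to \<open>w\<close>. So, by monotonicity, \<open>e w\<close>
  is an idempotent with image \<open>[1, w]\<close> (\<open>e_fixes_below\<close>, \<open>e_below\<close>).

  Any idempotent \<open>f\<close> fixes its values \<open>a\<close> at \<open>1\<close> and \<open>b\<close> at \<open>w\<^sub>0\<close>. A chain between two fixed points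
  keeps its length, hence is fixed pointwise, so the image of \<open>f\<close> is \<open>[a, b]\<close>. With \<open>b = w a\<close> this is
  the translate of \<open>[1, w]\<close> by \<open>a\<close>, and elements of \<open>M\<close> realize the translation in both directions;
  they conjugate \<open>f\<close> to \<open>e w\<close> (\<open>idempotent_conjugate_e\<close>). Conversely, if \<open>e w\<close> and \<open>e w'\<close> factor through
  each other, then \<open>w\<close> and \<open>w'\<close> have the same length, and some element of \<open>M\<close> maps \<open>1\<close> to \<open>1\<close> and
  \<open>w\<close> to \<open>w'\<close>; as labels are kept, \<open>w = w'\<close> (\<open>e_mem_ideal\<close>).

  From Coxeter groups this takes only the exchange condition, obtained from the presentation by
  counting reflections modulo 2, and the fact that \<open>w\<^sub>0\<close> is an involution lying above every element.
\<close>

section \<open>Words, reflections and the exchange condition\<close>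

lemma count_list_map_inj:
  assumes "inj_on g A" "set xs \<subseteq> A" "t \<in> A"
  shows "count_list (map g xs) (g t) = count_list xs t"
  using assms(2) by (induction xs) (use assms(1,3) in \<open>auto dest: inj_onD\<close>)

locale coxeter_group = group W for W :: "('a, 'b) monoid_scheme" (structure) +
  fixes I :: "'i set" and s :: "'i \<Rightarrow> 'a"
  assumes coxeter: "coxeter_system W I s"
begin

abbreviation wd :: "'i list \<Rightarrow> 'a" where "wd \<equiv> word_prod W s"
abbreviation len :: "'a \<Rightarrow> nat" where "len \<equiv> cox_length W I s"

lemma gen_closed [simp]: "i \<in> I \<Longrightarrow> s i \<in> carrier W"
  using coxeter by (auto simp: coxeter_system_def)

lemma wd_Nil [simp]: "wd [] = \<one>"
  by (simp add: word_prod_def)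

lemma wd_Cons [simp]: "wd (i # u) = s i \<otimes> wd u"
  by (simp add: word_prod_def)

lemma wd_closed [simp]: "u \<in> lists I \<Longrightarrow> wd u \<in> carrier W"
  by (induction u) auto

lemma wd_append: "u \<in> lists I \<Longrightarrow> v \<in> lists I \<Longrightarrow> wd (u @ v) = wd u \<otimes> wd v"
  by (induction u) (auto simp: m_assoc)

lemma exists_word: "w \<in> carrier W \<Longrightarrow> \<exists>u\<in>lists I. wd u = w"
  using coxeter unfolding coxeter_system_def by (metis imageE)

lemma obtain_presentation:
  obtains m where "coxeter_matrix I m"
    and "\<And>u v. u \<in> lists I \<Longrightarrow> v \<in> lists I \<Longrightarrow> wd u = wd v \<longleftrightarrow> coxeter_cong I m u v"
  using coxeter unfolding coxeter_system_def by blast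

lemma gen_square [simp]:
  assumes "i \<in> I"
  shows "s i \<otimes> s i = \<one>"
proof -
  obtain m where m: "coxeter_matrix I m"
    and eq: "\<And>u v. u \<in> lists I \<Longrightarrow> v \<in> lists I \<Longrightarrow> wd u = wd v \<longleftrightarrow> coxeter_cong I m u v"
    using obtain_presentation by blast
  have "m i i = 1" using m assms by (auto simp: coxeter_matrix_def)
  then have "coxeter_cong I m [i, i] []"
    using coxeter_cong.relation[of i I i m] assms by simp
  then have "wd [i, i] = wd []" using eq[of "[i, i]" "[]"] assms by simp
  then show ?thesis using assms by simp
qed

lemma gen_cancel [simp]: "i \<in> I \<Longrightarrow> x \<in> carrier W \<Longrightarrow> s i \<otimes> (s i \<otimes> x) = x"
  by (simp flip: m_assoc)

lemma inv_gen [simp]: "i \<in> I \<Longrightarrow> inv (s i) = s i"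
  by (simp add: inv_equality)

lemma wd_rev: "u \<in> lists I \<Longrightarrow> wd (rev u) = inv (wd u)"
  by (induction u) (auto simp: wd_append inv_mult_group lists_eq_set)

lemma exists_reduced:
  assumes "w \<in> carrier W"
  shows "\<exists>u\<in>lists I. wd u = w \<and> length u = len w"
proof -
  obtain u where "u \<in> lists I" "wd u = w" using exists_word assms by blast
  then have "\<exists>n. \<exists>u\<in>lists I. wd u = w \<and> length u = n" by blast
  then show ?thesis unfolding cox_length_def by (rule LeastI_ex)
qed

lemma len_wd_le: "u \<in> lists I \<Longrightarrow> len (wd u) \<le> length u"
  unfolding cox_length_def by (rule Least_le) auto

lemma len_one [simp]: "len \<one> = 0"
  using len_wd_le[of "[]"] by simp

lemma len_eq_0: "w \<in> carrier W \<Longrightarrow> len w = 0 \<Longrightarrow> w = \<one>"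
  using exists_reduced[of w] by auto

lemma len_mult_le:
  assumes "x \<in> carrier W" "y \<in> carrier W"
  shows "len (x \<otimes> y) \<le> len x + len y"
proof -
  obtain u v where "u \<in> lists I" "wd u = x" "length u = len x"
    and "v \<in> lists I" "wd v = y" "length v = len y"
    using exists_reduced assms by meson
  then show ?thesis using len_wd_le[of "u @ v"] by (simp add: wd_append)
qed

lemma len_gen_le: "i \<in> I \<Longrightarrow> len (s i) \<le> 1"
  using len_wd_le[of "[i]"] by simp

lemma len_inv [simp]:
  assumes "w \<in> carrier W"
  shows "len (inv w) = len w"
proof -
  have le: "len (inv x) \<le> len x" if x: "x \<in> carrier W" for x
  proof -
    obtain u where "u \<in> lists I" "wd u = x" "length u = len x"
      using exists_reduced x by meson
    then show ?thesis using len_wd_le[of "rev u"] by (simp add: wd_rev lists_eq_set)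
  qed
  show ?thesis using le[OF assms] le[of "inv w"] assms by simp
qed

text \<open>For a reduced word these are the left inversions of its product, that is, the reflections
  \<open>t\<close> for which \<open>t w\<close> is shorter than \<open>w\<close>.\<close>

primrec refls :: "'i list \<Rightarrow> 'a list" where
  "refls [] = []"
| "refls (i # u) = s i # map (\<lambda>t. s i \<otimes> t \<otimes> s i) (refls u)"

lemma refls_closed: "u \<in> lists I \<Longrightarrow> set (refls u) \<subseteq> carrier W"
  by (induction u) auto

lemma refls_append:
  assumes "u \<in> lists I" "v \<in> lists I"
  shows "refls (u @ v) = refls u @ map (\<lambda>t. wd u \<otimes> t \<otimes> inv (wd u)) (refls v)"
  using assms(1)
proof (induction u)
  case Nil
  then show ?case
    using refls_closed[OF assms(2)] by (auto simp: subset_iff intro!: map_idI[symmetric])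
next
  case (Cons i u)
  then show ?case
    using refls_closed[OF assms(2)]
    by (auto simp: m_assoc inv_mult_group subset_iff)
qed

text \<open>The reflection at the letter \<open>j\<close> of \<open>a @ j # b\<close> is the conjugate of \<open>s j\<close> by \<open>wd a\<close>, so that it
  cancels this letter.\<close>

lemma refl_deletes_letter:
  assumes "u \<in> lists I" "t \<in> set (refls u)"
  shows "\<exists>a j b. u = a @ j # b \<and> t \<otimes> wd u = wd (a @ b)"
  using assms
proof (induction u arbitrary: t)
  case (Cons i u)
  then have i: "i \<in> I" and u: "u \<in> lists I" by auto
  consider "t = s i" | t' where "t' \<in> set (refls u)" "t = s i \<otimes> t' \<otimes> s i"
    using Cons.prems by auto
  then show ?case
  proof cases
    case 1
    then show ?thesis using i u by (intro exI[of _ "[]"]) auto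
  next
    case 2
    then obtain a j b where ab: "u = a @ j # b" "t' \<otimes> wd u = wd (a @ b)"
      using Cons.IH u by blast
    have "t' \<in> carrier W" using 2 refls_closed u by blast
    then have "t \<otimes> wd (i # u) = wd ((i # a) @ b)"
      using 2 i u ab(2) by (simp add: m_assoc)
    then show ?thesis using ab(1) by (metis append_Cons)
  qed
qed simp

lemma refls_alternating:
  assumes "i \<in> I" "j \<in> I"
  shows "refls (concat (replicate n [i, j])) = map (\<lambda>k. (s i \<otimes> s j) [^] k \<otimes> s i) [0..<2 * n]"
proof (induction n)
  case (Suc n)
  let ?p = "s i \<otimes> s j"
  let ?u = "concat (replicate n [i, j])"
  have u: "?u \<in> lists I" using assms by (auto simp: lists_eq_set)
  have p: "?p \<in> carrier W" using assms by simp
  have step: "?p \<otimes> (?p [^] (k::nat) \<otimes> s i) \<otimes> inv ?p = ?p [^] Suc (Suc k) \<otimes> s i" for k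
  proof -
    have "s i \<otimes> inv ?p = ?p \<otimes> s i" using assms by (simp add: inv_mult_group m_assoc)
    then have "?p \<otimes> (?p [^] k \<otimes> s i) \<otimes> inv ?p = ?p \<otimes> ?p [^] k \<otimes> ?p \<otimes> s i"
      using assms by (simp add: m_assoc)
    also have "?p \<otimes> ?p [^] k = ?p [^] Suc k"
      using nat_pow_Suc2[OF p] by simp
    also have "\<dots> \<otimes> ?p = ?p [^] Suc (Suc k)" by simp
    finally show ?thesis .
  qed
  have "refls (concat (replicate (Suc n) [i, j])) =
      refls [i, j] @ map (\<lambda>t. ?p \<otimes> t \<otimes> inv ?p) (refls ?u)"
    using refls_append[of "[i, j]" ?u] assms u by simp
  also have "\<dots> = [s i, ?p \<otimes> s i] @ map (\<lambda>k. ?p [^] Suc (Suc k) \<otimes> s i) [0..<2 * n]"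
    unfolding Suc.IH using step by (simp add: o_def del: nat_pow_Suc)
  also have "\<dots> = map (\<lambda>k. ?p [^] k \<otimes> s i) [0..<Suc (Suc (2 * n))]"
    using assms by (simp add: upt_conv_Cons map_Suc_upt[symmetric] o_def
        del: nat_pow_Suc upt_Suc)
  finally show ?case by simp
qed simp

text \<open>How often a given element occurs among the reflections of a word depends, modulo 2, only on
  the product of the word: in a defining relation \<open>(i j)^m\<close> the second half of the list of
  reflections repeats the first half.\<close>

lemma refls_parity:
  assumes "u \<in> lists I" "v \<in> lists I" "wd u = wd v" "t \<in> carrier W"
  shows "even (count_list (refls u) t) \<longleftrightarrow> even (count_list (refls v) t)"
proof -
  obtain m
    where eq: "\<And>u v. u \<in> lists I \<Longrightarrow> v \<in> lists I \<Longrightarrow> wd u = wd v \<longleftrightarrow> coxeter_cong I m u v"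
    using obtain_presentation by blast
  have "u \<in> lists I \<and> v \<in> lists I \<and> wd u = wd v \<and>
      (\<forall>t\<in>carrier W. even (count_list (refls u) t) \<longleftrightarrow> even (count_list (refls v) t))"
    if "coxeter_cong I m u v" for u v
    using that
  proof induction
    case (relation i j)
    let ?p = "s i \<otimes> s j" and ?n = "m i j"
    let ?u = "concat (replicate ?n [i, j])"
    have u: "?u \<in> lists I" using relation by (auto simp: lists_eq_set)
    have wd1: "wd ?u = \<one>"
      using eq[OF u, of "[]"] coxeter_cong.relation[OF relation, of m] by simp
    have "wd (concat (replicate n [i, j])) = ?p [^] n" for n :: nat
    proof (induction n)
      case (Suc n)
      have "concat (replicate n [i, j]) \<in> lists I" using relation by (auto simp: lists_eq_set)
      then show ?case using relation Suc nat_pow_Suc2[of ?p n]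
        by (simp add: m_assoc del: nat_pow_Suc)
    qed simp
    then have p1: "?p [^] ?n = \<one>" using wd1 by simp
    have "?p [^] (k + ?n) = ?p [^] k" for k
      using nat_pow_mult[of ?p k ?n] p1 relation by simp
    then have "map (\<lambda>k. ?p [^] k \<otimes> s i) [?n..<2 * ?n] = map (\<lambda>k. ?p [^] k \<otimes> s i) [0..<?n]"
      by (intro nth_equalityI) (simp_all add: add.commute)
    moreover have "[0..<2 * ?n] = [0..<?n] @ [?n..<2 * ?n]"
      using upt_add_eq_append[of 0 ?n ?n] by (simp add: mult_2)
    ultimately have "refls ?u = map (\<lambda>k. ?p [^] k \<otimes> s i) [0..<?n] @ map (\<lambda>k. ?p [^] k \<otimes> s i) [0..<?n]"
      by (simp add: refls_alternating relation)
    then show ?case using u wd1 by simp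
  next
    case (append u u' v v')
    have conj: "count_list (map (\<lambda>t. x \<otimes> t \<otimes> inv x) r) t = count_list r (inv x \<otimes> t \<otimes> x)"
      if "x \<in> carrier W" "set r \<subseteq> carrier W" "t \<in> carrier W" for x r t
    proof -
      have "inj_on (\<lambda>t. x \<otimes> t \<otimes> inv x) (carrier W)"
        using that by (auto intro!: inj_onI)
      moreover have "x \<otimes> (inv x \<otimes> t \<otimes> x) \<otimes> inv x = t"
        using that by (simp add: m_assoc) (simp flip: m_assoc)
      ultimately show ?thesis
        using count_list_map_inj[of "\<lambda>t. x \<otimes> t \<otimes> inv x" "carrier W" r "inv x \<otimes> t \<otimes> x"] that by simp
    qed
    show ?case
      using append.IH by (auto simp: refls_append wd_append conj refls_closed)
  qed auto
  then show ?thesis using eq assms by blast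
qed

text \<open>If \<open>s i\<close> occurred an even number of times among the reflections of \<open>u\<close>, then it would occur
  an odd number of times for the word \<open>i # u\<close>, hence also for a reduced word of \<open>s i \<otimes> wd u\<close>;
  deleting the letter found there would make \<open>wd u\<close> shorter than \<open>s i \<otimes> wd u\<close>.\<close>

lemma exchange:
  assumes i: "i \<in> I" and u: "u \<in> lists I" and le: "len (s i \<otimes> wd u) \<le> len (wd u)"
  shows "\<exists>a j b. u = a @ j # b \<and> s i \<otimes> wd u = wd (a @ b)"
proof -
  have "s i \<in> set (refls u)"
  proof (rule ccontr)
    assume "s i \<notin> set (refls u)"
    then have "count_list (refls u) (s i) = 0" by (simp add: count_list_0_iff)
    moreover have "count_list (map (\<lambda>t. s i \<otimes> t \<otimes> s i) (refls u)) (s i \<otimes> s i \<otimes> s i)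
        = count_list (refls u) (s i)"
    proof (rule count_list_map_inj[where A = "carrier W"])
      show "inj_on (\<lambda>t. s i \<otimes> t \<otimes> s i) (carrier W)" using i by (auto intro!: inj_onI)
    qed (use i u refls_closed in auto)
    ultimately have odd: "odd (count_list (refls (i # u)) (s i))" using i by simp
    obtain v where v: "v \<in> lists I" "wd v = s i \<otimes> wd u" "length v = len (s i \<otimes> wd u)"
      using exists_reduced[of "s i \<otimes> wd u"] i u by auto
    have "odd (count_list (refls v) (s i))"
      using refls_parity[of "i # u" v "s i"] odd i u v by simp
    then have "s i \<in> set (refls v)" by (metis count_list_0_iff even_zero)
    then obtain a j b where ab: "v = a @ j # b" "s i \<otimes> wd v = wd (a @ b)"
      using refl_deletes_letter v by blast
    then have "len (wd u) \<le> length (a @ b)"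
      using len_wd_le[of "a @ b"] v i u by simp
    then show False using ab v le by simp
  qed
  then show ?thesis using refl_deletes_letter u by blast
qed

lemma len_gen_mult_neq:
  assumes "i \<in> I" "w \<in> carrier W"
  shows "len (s i \<otimes> w) \<noteq> len w"
proof
  assume eq: "len (s i \<otimes> w) = len w"
  obtain u where u: "u \<in> lists I" "wd u = w" "length u = len w"
    using exists_reduced assms by meson
  then obtain a j b where ab: "u = a @ j # b" "s i \<otimes> w = wd (a @ b)"
    using exchange[of i u] assms eq by auto
  then have "len (s i \<otimes> w) \<le> length (a @ b)" using len_wd_le[of "a @ b"] u by simp
  then show False using ab u eq by simp
qed

lemma len_mult_gen_neq:
  assumes "i \<in> I" "w \<in> carrier W"
  shows "len (w \<otimes> s i) \<noteq> len w"
  using len_gen_mult_neq[of i "inv w"] len_inv[of "w \<otimes> s i"] assms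
  by (simp add: inv_mult_group)

lemma len_gen_mult_le: "i \<in> I \<Longrightarrow> w \<in> carrier W \<Longrightarrow> len (s i \<otimes> w) \<le> Suc (len w)"
  using len_mult_le[of "s i" w] len_gen_le[of i] by simp

lemma len_mult_gen_le: "i \<in> I \<Longrightarrow> w \<in> carrier W \<Longrightarrow> len (w \<otimes> s i) \<le> Suc (len w)"
  using len_mult_le[of w "s i"] len_gen_le[of i] by simp

text \<open>The one place where left and right multiplication interact: if both lengthen \<open>w\<close>, but the
  product with both is not longer still, then they have the same effect on \<open>w\<close>.\<close>

lemma gen_mult_eq_mult_gen:
  assumes i: "i \<in> I" and j: "j \<in> I" and w: "w \<in> carrier W"
    and up_left: "len w < len (s j \<otimes> w)" and up_right: "len w < len (w \<otimes> s i)"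
    and down: "len (s j \<otimes> w \<otimes> s i) < len (s j \<otimes> w)"
  shows "s j \<otimes> w = w \<otimes> s i"
proof -
  obtain u where u: "u \<in> lists I" "wd u = w" "length u = len w"
    using exists_reduced w by meson
  have ui: "wd (u @ [i]) = w \<otimes> s i" "u @ [i] \<in> lists I" using u i by (auto simp: wd_append)
  have "len (s j \<otimes> (w \<otimes> s i)) \<le> len (w \<otimes> s i)"
    using down up_right len_gen_mult_le[OF j w] i j w by (simp add: m_assoc)
  then obtain a k b where ab: "u @ [i] = a @ k # b" "s j \<otimes> (w \<otimes> s i) = wd (a @ b)"
    using exchange[OF j ui(2)] ui(1) by auto
  show ?thesis
  proof (cases b rule: rev_cases)
    case Nil
    then have "s j \<otimes> (w \<otimes> s i) = w" using ab u by simp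
    then show ?thesis using gen_cancel[of j "w \<otimes> s i"] i j w by simp
  next
    case (snoc c l)
    then have l: "l = i" and u': "u = a @ k # c" using ab by auto
    then have ac: "a @ c \<in> lists I" using u by auto
    have "s j \<otimes> w \<otimes> s i = wd (a @ c) \<otimes> s i"
      using ab(2) snoc l ac i j w wd_append[of "a @ c" "[i]"] by (simp add: m_assoc)
    then have "s j \<otimes> w = wd (a @ c)" using i j w ac by simp
    then have "len (s j \<otimes> w) < len w" using len_wd_le[OF ac] u u' by simp
    then show ?thesis using up_left by simp
  qed
qed

end

section \<open>The left weak order and the longest element\<close>

context coxeter_group
begin

definition left_le :: "'a \<Rightarrow> 'a \<Rightarrow> bool" where
  "left_le x z \<longleftrightarrow> (\<exists>u\<in>lists I. z = wd u \<otimes> x \<and> len z = length u + len x)"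

lemma left_le_iff:
  assumes "x \<in> carrier W" "z \<in> carrier W"
  shows "left_le x z \<longleftrightarrow> len z = len (z \<otimes> inv x) + len x"
proof
  assume "left_le x z"
  then obtain u where u: "u \<in> lists I" "z = wd u \<otimes> x" "len z = length u + len x"
    by (auto simp: left_le_def)
  then have "z \<otimes> inv x = wd u" using assms by (simp add: m_assoc)
  moreover have "len z \<le> len (wd u) + len x" using u assms len_mult_le[of "wd u" x] by simp
  ultimately show "len z = len (z \<otimes> inv x) + len x"
    using u(2,3) len_wd_le[OF u(1)] by simp
next
  assume len: "len z = len (z \<otimes> inv x) + len x"
  obtain u where u: "u \<in> lists I" "wd u = z \<otimes> inv x" "length u = len (z \<otimes> inv x)"
    using exists_reduced[of "z \<otimes> inv x"] assms by auto
  then have "z = wd u \<otimes> x" using assms by (simp add: m_assoc)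
  then show "left_le x z" using len u unfolding left_le_def by (intro bexI[of _ u]) simp_all
qed

lemma left_le_one: "x \<in> carrier W \<Longrightarrow> left_le \<one> x"
  by (simp add: left_le_iff)

lemma left_le_len: "left_le x z \<Longrightarrow> len x \<le> len z"
  by (auto simp: left_le_def)

lemma left_le_len_eq: "left_le x z \<Longrightarrow> x \<in> carrier W \<Longrightarrow> len x = len z \<Longrightarrow> x = z"
  by (auto simp: left_le_def)

text \<open>An interval \<open>[a, w a]\<close> of the left weak order is the translate of \<open>[\<one>, w]\<close>.\<close>

lemma left_le_translate:
  assumes a: "a \<in> carrier W" and w: "w \<in> carrier W" and y: "y \<in> carrier W"
    and len: "len (w \<otimes> a) = len w + len a" and le: "left_le y w"
  shows "len (y \<otimes> a) = len y + len a" "left_le a (y \<otimes> a)" "left_le (y \<otimes> a) (w \<otimes> a)"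
proof -
  obtain u where u: "u \<in> lists I" "w = wd u \<otimes> y" "len w = length u + len y"
    using le by (auto simp: left_le_def)
  have "w \<otimes> a = wd u \<otimes> (y \<otimes> a)" using u a y by (simp add: m_assoc)
  moreover from this have "len (w \<otimes> a) \<le> length u + len (y \<otimes> a)"
    using len_mult_le[of "wd u" "y \<otimes> a"] len_wd_le[of u] u a y by simp
  moreover have "len (y \<otimes> a) \<le> len y + len a" using len_mult_le a y by simp
  ultimately show eq: "len (y \<otimes> a) = len y + len a" and "left_le (y \<otimes> a) (w \<otimes> a)"
    using u len by (auto simp: left_le_def)
  show "left_le a (y \<otimes> a)" using eq a y by (simp add: left_le_iff m_assoc)
qed

lemma left_le_untranslate:
  assumes a: "a \<in> carrier W" and w: "w \<in> carrier W"
    and len: "len (w \<otimes> a) = len w + len a"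
    and c: "left_le a c" "left_le c (w \<otimes> a)"
  shows "\<exists>y\<in>carrier W. left_le y w \<and> c = y \<otimes> a"
proof -
  obtain u where u: "u \<in> lists I" "c = wd u \<otimes> a" "len c = length u + len a"
    using c unfolding left_le_def by blast
  obtain v where v: "v \<in> lists I" "w \<otimes> a = wd v \<otimes> c" "len (w \<otimes> a) = length v + len c"
    using c unfolding left_le_def by blast
  have "w \<otimes> a = (wd v \<otimes> wd u) \<otimes> a" using u v a by (simp add: m_assoc)
  then have "w = wd v \<otimes> wd u" using u v a w by simp
  moreover have "len (wd u) = length u"
    using u a len_mult_le[of "wd u" a] len_wd_le[of u] by simp
  ultimately have "left_le (wd u) w" using u v len by (auto simp: left_le_def)
  then show ?thesis using u wd_closed[OF u(1)] by blast
qed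

text \<open>Every reduced word begins a reduced word of an element of maximal length. If a reduced word
  \<open>u @ x\<close> of that element begins with \<open>u\<close>, then multiplying by \<open>s i\<close> deletes one of its letters. When
  \<open>i # u\<close> is reduced, that letter lies in \<open>x\<close>, and \<open>i\<close> in front can replace it.\<close>

lemma reduced_extends_to_maximal:
  assumes z: "z \<in> carrier W" and max: "\<And>w. w \<in> carrier W \<Longrightarrow> len w \<le> len z"
    and "u \<in> lists I" "length u = len (wd u)"
  shows "\<exists>x\<in>lists I. z = wd (u @ x) \<and> len z = length (u @ x)"
  using assms(3,4)
proof (induction u)
  case Nil
  then show ?case using exists_reduced[OF z] by auto
next
  case (Cons i u)
  then have i: "i \<in> I" and u: "u \<in> lists I" by auto
  have "length u = len (wd u)"
    using Cons.prems len_gen_mult_le[OF i, of "wd u"] len_wd_le[OF u] u by simp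
  then obtain x where x: "x \<in> lists I" "z = wd (u @ x)" "len z = length (u @ x)"
    using Cons.IH u by blast
  obtain a j b where ab: "u @ x = a @ j # b" "s i \<otimes> z = wd (a @ b)"
    using exchange[OF i, of "u @ x"] max[of "s i \<otimes> z"] x u i z by auto
  have "\<not> (\<exists>c. u = a @ j # c \<and> b = c @ x)"
  proof
    assume "\<exists>c. u = a @ j # c \<and> b = c @ x"
    then obtain c where c: "u = a @ j # c" "b = c @ x" by blast
    then have ac: "a @ c \<in> lists I" using u by auto
    have "(s i \<otimes> wd u) \<otimes> wd x = wd (a @ c) \<otimes> wd x"
      using ab(2) c(2) x i u ac wd_append[OF ac x(1)] by (simp add: wd_append m_assoc)
    then have "s i \<otimes> wd u = wd (a @ c)" using i u x ac by simp
    then have "len (wd (i # u)) < length u" using len_wd_le[OF ac] c by simp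
    then show False using Cons.prems by simp
  qed
  then obtain c where c: "a = u @ c" "x = c @ j # b"
    using ab(1) by (auto simp: append_eq_append_conv2 append_eq_Cons_conv)
  have "z = s i \<otimes> wd (a @ b)" using ab(2) i z gen_cancel by metis
  then show ?case using c x i by (intro bexI[of _ "c @ b"]) auto
qed

end

locale finite_coxeter_group = coxeter_group +
  assumes finite_W: "finite (carrier W)"
begin

abbreviation w0 :: 'a where "w0 \<equiv> longest_element W I s"

lemma w0_closed [simp]: "w0 \<in> carrier W"
  and len_le_w0: "w \<in> carrier W \<Longrightarrow> len w \<le> len w0"
proof -
  have "\<forall>w. w \<in> carrier W \<longrightarrow> len w < Suc (Max (len ` carrier W))"
    using finite_W by (simp add: less_Suc_eq_le)
  then have "w0 \<in> carrier W \<and> (\<forall>w. w \<in> carrier W \<longrightarrow> len w \<le> len w0)"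
    unfolding longest_element_def by (rule arg_max_nat_lemma[where P = "\<lambda>w. w \<in> carrier W", OF one_closed])
  then show "w0 \<in> carrier W" "w \<in> carrier W \<Longrightarrow> len w \<le> len w0" by auto
qed

text \<open>The inverse of \<open>w\<^sub>0\<close> is also of maximal length, so a reduced word of \<open>w\<^sub>0\<close> extends to a reduced
  word of it; both words have the same length.\<close>

lemma inv_w0 [simp]: "inv w0 = w0"
proof -
  obtain u where u: "u \<in> lists I" "wd u = w0" "length u = len w0"
    using exists_reduced[OF w0_closed] by auto
  have "\<exists>x\<in>lists I. inv w0 = wd (u @ x) \<and> len (inv w0) = length (u @ x)"
    using u len_le_w0 by (intro reduced_extends_to_maximal) auto
  then show ?thesis using u by simp
qed

lemma w0_cancel [simp]: "x \<in> carrier W \<Longrightarrow> w0 \<otimes> (w0 \<otimes> x) = x"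
  using inv_w0 r_inv[OF w0_closed] by (simp flip: m_assoc)

lemma len_inv_mult_w0:
  assumes "w \<in> carrier W"
  shows "len w + len (inv w \<otimes> w0) = len w0"
proof -
  obtain u where u: "u \<in> lists I" "wd u = w" "length u = len w"
    using exists_reduced assms by meson
  then obtain x where x: "x \<in> lists I" "w0 = wd (u @ x)" "len w0 = length (u @ x)"
    using reduced_extends_to_maximal[OF w0_closed len_le_w0, of u] by blast
  then have w0: "w0 = w \<otimes> wd x" using u by (simp add: wd_append)
  then have "inv w \<otimes> w0 = wd x" using x(1) assms by (simp flip: m_assoc)
  then show ?thesis
    using w0 x u len_wd_le[of x] len_mult_le[of w "wd x"] assms by simp
qed

lemma len_w0_mult:
  assumes "w \<in> carrier W"
  shows "len (w0 \<otimes> w) = len (inv w \<otimes> w0)"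
  using len_inv[of "inv w \<otimes> w0"] assms by (simp add: inv_mult_group)

lemma left_le_w0:
  assumes "w \<in> carrier W"
  shows "left_le w w0"
  using len_inv_mult_w0[of "inv w"] len_w0_mult[of "inv w"] assms by (simp add: left_le_iff)

end


section \<open>The biHecke monoid and the left weak order\<close>

lemma (in monoid) two_sided_ideal_eqI:
  assumes "a \<in> carrier G" "b \<in> carrier G" "c \<in> carrier G" "d \<in> carrier G"
    and "e \<in> carrier G" "f \<in> carrier G"
    and e: "e = a \<otimes> f \<otimes> b" and f: "f = c \<otimes> e \<otimes> d"
  shows "two_sided_ideal G e = two_sided_ideal G f"
proof -
  have sub: "two_sided_ideal G x \<subseteq> two_sided_ideal G y"
    if cl: "p \<in> carrier G" "q \<in> carrier G" "y \<in> carrier G" and x: "x = p \<otimes> y \<otimes> q" for p q x y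
  proof
    fix t assume "t \<in> two_sided_ideal G x"
    then obtain g h where gh: "g \<in> carrier G" "h \<in> carrier G" "t = g \<otimes> x \<otimes> h"
      by (auto simp: two_sided_ideal_def)
    then have "t = (g \<otimes> p) \<otimes> y \<otimes> (q \<otimes> h)" using x cl by (simp add: m_assoc)
    then show "t \<in> two_sided_ideal G y" using gh cl by (auto simp: two_sided_ideal_def)
  qed
  show ?thesis using sub[OF _ _ _ e] sub[OF _ _ _ f] assms by blast
qed

lemma (in monoid) mem_two_sided_ideal: "e \<in> carrier G \<Longrightarrow> e \<in> two_sided_ideal G e"
  unfolding two_sided_ideal_def by (auto intro!: exI[of _ \<one>])

context coxeter_group
begin

abbreviation M :: "('a \<Rightarrow> 'a) monoid" where "M \<equiv> biHecke_monoid W I s"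

lemma mult_M: "f \<otimes>\<^bsub>M\<^esub> g = compose (carrier W) g f"
  by (simp add: biHecke_monoid_def transformation_monoid_def Let_def)

lemma mult_M_apply [simp]: "x \<in> carrier W \<Longrightarrow> (f \<otimes>\<^bsub>M\<^esub> g) x = g (f x)"
  by (simp add: mult_M compose_def)

lemma one_M: "\<one>\<^bsub>M\<^esub> = (\<lambda>x\<in>carrier W. x)"
  by (simp add: biHecke_monoid_def transformation_monoid_def Let_def)

lemma carrier_M:
  "carrier M = submonoid_generated (transformation_monoid (carrier W))
     (hecke_pi W I s ` I \<union> hecke_pi_bar W I s ` I)"
  by (simp add: biHecke_monoid_def Let_def)

lemma one_M_mem: "\<one>\<^bsub>M\<^esub> \<in> carrier M"
  unfolding carrier_M using submonoid_generated.one
  by (fastforce simp: biHecke_monoid_def Let_def)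

lemma mult_M_mem [simp]: "f \<in> carrier M \<Longrightarrow> g \<in> carrier M \<Longrightarrow> f \<otimes>\<^bsub>M\<^esub> g \<in> carrier M"
  unfolding carrier_M using submonoid_generated.mult
  by (fastforce simp: biHecke_monoid_def Let_def)

lemma pi_mem: "i \<in> I \<Longrightarrow> hecke_pi W I s i \<in> carrier M"
  and pi_bar_mem: "i \<in> I \<Longrightarrow> hecke_pi_bar W I s i \<in> carrier M"
  unfolding carrier_M by (auto intro: submonoid_generated.incl)

lemma M_induct [consumes 1, case_names one pi pi_bar mult]:
  assumes "f \<in> carrier M"
    and "P (\<lambda>x\<in>carrier W. x)"
    and "\<And>i. i \<in> I \<Longrightarrow> P (hecke_pi W I s i)" "\<And>i. i \<in> I \<Longrightarrow> P (hecke_pi_bar W I s i)"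
    and "\<And>f g. f \<in> carrier M \<Longrightarrow> g \<in> carrier M \<Longrightarrow> P f \<Longrightarrow> P g \<Longrightarrow> P (f \<otimes>\<^bsub>M\<^esub> g)"
  shows "P f"
  using assms(1) unfolding carrier_M
proof induction
  case one
  have "\<one>\<^bsub>transformation_monoid (carrier W)\<^esub> = (\<lambda>x\<in>carrier W. x)"
    by (simp add: transformation_monoid_def)
  then show ?case using assms(2) by (simp only:)
next
  case (mult f g)
  then show ?case using assms(5)[of f g]
    by (simp add: carrier_M mult_M) (simp add: transformation_monoid_def)
qed (use assms(3,4) in auto)

lemma pi_apply:
  assumes "i \<in> I" "x \<in> carrier W"
  shows "hecke_pi W I s i x = (if len x < len (x \<otimes> s i) then x \<otimes> s i else x)"
  using len_mult_gen_neq[OF assms] assms by (auto simp: hecke_pi_def right_descents_def)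

lemma pi_bar_apply:
  assumes "i \<in> I" "x \<in> carrier W"
  shows "hecke_pi_bar W I s i x = (if len (x \<otimes> s i) < len x then x \<otimes> s i else x)"
  using assms by (auto simp: hecke_pi_bar_def right_descents_def)

lemma M_PiE: "f \<in> carrier M \<Longrightarrow> f \<in> carrier W \<rightarrow>\<^sub>E carrier W"
proof (induction rule: M_induct)
  case (mult f g)
  then show ?case by (auto simp: mult_M compose_def)
qed (auto simp: hecke_pi_def hecke_pi_bar_def)

lemma M_closed [simp]: "f \<in> carrier M \<Longrightarrow> x \<in> carrier W \<Longrightarrow> f x \<in> carrier W"
  using M_PiE by blast

lemma M_eqI:
  assumes "f \<in> carrier M" "g \<in> carrier M" "\<And>x. x \<in> carrier W \<Longrightarrow> f x = g x"
  shows "f = g"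
  using M_PiE[OF assms(1)] M_PiE[OF assms(2)] assms(3) by (rule PiE_ext)

lemma monoid_M: "monoid M"
proof
  fix f g h assume fgh: "f \<in> carrier M" "g \<in> carrier M" "h \<in> carrier M"
  then show "f \<otimes>\<^bsub>M\<^esub> g \<otimes>\<^bsub>M\<^esub> h = f \<otimes>\<^bsub>M\<^esub> (g \<otimes>\<^bsub>M\<^esub> h)"
    by (intro M_eqI) auto
next
  fix f assume "f \<in> carrier M"
  then show "\<one>\<^bsub>M\<^esub> \<otimes>\<^bsub>M\<^esub> f = f" "f \<otimes>\<^bsub>M\<^esub> \<one>\<^bsub>M\<^esub> = f"
    using one_M_mem by (auto intro!: M_eqI simp: one_M)
qed (auto intro: one_M_mem)

text \<open>Elements of the biHecke monoid either contract a covering pair \<open>w < s j w\<close> of the left weak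
  order or carry it to a covering pair with the same label \<open>j\<close>. For a generator with index \<open>i\<close>, the pair
  is contracted exactly when \<open>s j w = w s i\<close>; otherwise right multiplication by \<open>s i\<close> has the same
  effect on the length of both elements.\<close>

lemma M_cover:
  assumes "f \<in> carrier M" "j \<in> I" "w \<in> carrier W" "len w < len (s j \<otimes> w)"
  shows "f (s j \<otimes> w) = f w \<or> f (s j \<otimes> w) = s j \<otimes> f w \<and> len (f w) < len (s j \<otimes> f w)"
  using assms
proof (induction arbitrary: w rule: M_induct)
  case (mult f g)
  show ?case
  proof (cases "f (s j \<otimes> w) = f w")
    case True
    then show ?thesis using mult.prems by simp
  next
    case False
    then have "f (s j \<otimes> w) = s j \<otimes> f w" "len (f w) < len (s j \<otimes> f w)"
      using mult.IH(1) mult.prems by blast+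
    then show ?thesis using mult.IH(2)[of "f w"] mult.hyps mult.prems by simp
  qed
next
  case (pi i)
  note bounds = len_gen_mult_le[of j w] len_gen_mult_le[of j "w \<otimes> s i"] len_mult_gen_le[of i w]
    len_mult_gen_le[of i "s j \<otimes> w"] len_mult_gen_neq[of i w] len_mult_gen_neq[of i "s j \<otimes> w"]
  show ?case
    using gen_mult_eq_mult_gen[of i j w] bounds pi by (auto simp: pi_apply m_assoc)
next
  case (pi_bar i)
  have cancel: "s j \<otimes> (w \<otimes> s i) = w" if "s j \<otimes> w = w \<otimes> s i"
    using gen_cancel[of j w] that pi_bar by simp
  note bounds = len_gen_mult_le[of j w] len_gen_mult_le[of j "w \<otimes> s i"] len_mult_gen_le[of i w]
    len_mult_gen_le[of i "s j \<otimes> w \<otimes> s i"] len_mult_gen_neq[of i w] len_mult_gen_neq[of i "s j \<otimes> w"]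
  show ?case
    using gen_mult_eq_mult_gen[of i j w] cancel bounds pi_bar by (auto simp: pi_bar_apply m_assoc)
qed auto

lemma M_subword:
  assumes f: "f \<in> carrier M" and x: "x \<in> carrier W"
    and "u \<in> lists I" "len (wd u \<otimes> x) = length u + len x"
  shows "\<exists>v\<in>lists I. subseq v u \<and> f (wd u \<otimes> x) = wd v \<otimes> f x \<and>
    len (f (wd u \<otimes> x)) = length v + len (f x)"
  using assms(3,4)
proof (induction u)
  case Nil
  then show ?case using f x by auto
next
  case (Cons j u)
  then have j: "j \<in> I" and u: "u \<in> lists I" by auto
  let ?y = "wd u \<otimes> x"
  have y: "?y \<in> carrier W" "wd (j # u) \<otimes> x = s j \<otimes> ?y" using j u x by (auto simp: m_assoc)
  have "len (s j \<otimes> ?y) \<le> Suc (len ?y)" "len ?y \<le> length u + len x"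
    using len_gen_mult_le[OF j y(1)] len_mult_le[of "wd u" x] len_wd_le[OF u] u x by auto
  then have len: "len ?y = length u + len x" "len ?y < len (s j \<otimes> ?y)"
    using Cons.prems y by auto
  obtain v where v: "v \<in> lists I" "subseq v u" "f ?y = wd v \<otimes> f x"
      "len (f ?y) = length v + len (f x)"
    using Cons.IH u len by blast
  consider "f (s j \<otimes> ?y) = f ?y"
    | "f (s j \<otimes> ?y) = s j \<otimes> f ?y" "len (f ?y) < len (s j \<otimes> f ?y)"
    using M_cover[OF f j y(1) len(2)] by blast
  then show ?case
  proof cases
    case 1
    then show ?thesis using v y(2) by (intro bexI[of _ v]) auto
  next
    case 2
    moreover have "len (s j \<otimes> f ?y) \<le> Suc (len (f ?y))"
      using len_gen_mult_le j f y(1) by simp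
    ultimately show ?thesis
      using v y(2) j f x by (intro bexI[of _ "j # v"]) (auto simp: m_assoc)
  qed
qed

lemma M_mono:
  assumes "f \<in> carrier M" "x \<in> carrier W" "left_le x z"
  shows "left_le (f x) (f z)"
  using M_subword[OF assms(1,2)] assms(3) unfolding left_le_def by metis

text \<open>A function in the biHecke monoid cannot lengthen a chain, and a chain whose length it keeps
  retains its labels.\<close>

lemma M_interval:
  assumes "f \<in> carrier M" "x \<in> carrier W" "z \<in> carrier W" "left_le x z"
  shows "len (f z) + len x \<le> len z + len (f x)"
    and "len (f z) + len x = len z + len (f x) \<Longrightarrow> f z = z \<otimes> inv x \<otimes> f x"
proof -
  obtain u where u: "u \<in> lists I" "z = wd u \<otimes> x" "len z = length u + len x"
    using assms unfolding left_le_def by blast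
  obtain v where v: "subseq v u" "f z = wd v \<otimes> f x" "len (f z) = length v + len (f x)"
    using M_subword[OF assms(1,2) u(1)] u(2,3) by auto
  show "len (f z) + len x \<le> len z + len (f x)"
    using u v list_emb_length[OF v(1)] by simp
  assume "len (f z) + len x = len z + len (f x)"
  then have "v = u" using u v subseq_same_length[OF v(1)] by simp
  then show "f z = z \<otimes> inv x \<otimes> f x" using u v assms by (simp add: m_assoc)
qed

lemma M_fixes_between:
  assumes f: "f \<in> carrier M" and c: "a \<in> carrier W" "c \<in> carrier W" "b \<in> carrier W"
    and le: "left_le a c" "left_le c b" and fix_ends: "f a = a" "f b = b"
  shows "f c = c"
proof -
  have "len (f c) = len c"
    using M_interval(1)[OF f c(1,2) le(1)] M_interval(1)[OF f c(2,3) le(2)] fix_ends by simp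
  then show ?thesis using M_interval(2)[OF f c(1,2) le(1)] fix_ends c by (simp add: m_assoc)
qed

lemma word_prod_M_Nil [simp]: "word_prod M g [] = \<one>\<^bsub>M\<^esub>"
  by (simp add: word_prod_def)

lemma word_prod_M_Cons [simp]: "word_prod M g (i # u) = g i \<otimes>\<^bsub>M\<^esub> word_prod M g u"
  by (simp add: word_prod_def)

lemma word_prod_M_mem:
  assumes "\<And>i. i \<in> I \<Longrightarrow> g i \<in> carrier M" "u \<in> lists I"
  shows "word_prod M g u \<in> carrier M"
  using assms(2) by (induction u) (auto simp: one_M_mem assms(1))

lemma pi_word_apply:
  assumes "u \<in> lists I" "x \<in> carrier W" "len (x \<otimes> wd u) = len x + length u"
  shows "word_prod M (hecke_pi W I s) u x = x \<otimes> wd u"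
  using assms
proof (induction u arbitrary: x)
  case (Cons i u)
  then have i: "i \<in> I" and u: "u \<in> lists I" and x: "x \<in> carrier W" by auto
  have "len (x \<otimes> s i \<otimes> wd u) = len x + Suc (length u)"
    using Cons.prems i u by (simp add: m_assoc)
  moreover from this have "len (x \<otimes> s i) = Suc (len x)"
    using len_mult_le[of "x \<otimes> s i" "wd u"] len_wd_le[OF u] len_mult_gen_le[OF i x] i u x by simp
  ultimately show ?case using Cons.IH[of "x \<otimes> s i"] i u x by (simp add: pi_apply m_assoc)
qed (simp add: one_M)

lemma pi_bar_word_apply:
  assumes "u \<in> lists I" "x \<in> carrier W" "len x = len (x \<otimes> wd u) + length u"
  shows "word_prod M (hecke_pi_bar W I s) u x = x \<otimes> wd u"
  using assms
proof (induction u arbitrary: x)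
  case (Cons i u)
  then have i: "i \<in> I" and u: "u \<in> lists I" and x: "x \<in> carrier W" by auto
  have eq: "len x = len (x \<otimes> s i \<otimes> wd u) + Suc (length u)"
    using Cons.prems i u by (simp add: m_assoc)
  moreover have "len (x \<otimes> s i) \<le> len (x \<otimes> s i \<otimes> wd u) + len (inv (wd u))"
    using len_mult_le[of "x \<otimes> s i \<otimes> wd u" "inv (wd u)"] i u x by (simp add: m_assoc)
  ultimately have "Suc (len (x \<otimes> s i)) = len x"
    using len_wd_le[OF u] len_mult_gen_le[of i "x \<otimes> s i"] i u x by (simp add: m_assoc)
  then show ?case using Cons.IH[of "x \<otimes> s i"] eq i u x by (simp add: pi_bar_apply m_assoc)
qed (simp add: one_M)

lemma some_reduced_word:
  assumes "v \<in> carrier W"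
  shows "some_reduced_word W I s v \<in> lists I" "wd (some_reduced_word W I s v) = v"
    "length (some_reduced_word W I s v) = len v"
proof -
  have "\<exists>u. is_reduced_word W I s u v"
    using exists_reduced[OF assms] by (auto simp: is_reduced_word_def)
  then have "is_reduced_word W I s (some_reduced_word W I s v) v"
    unfolding some_reduced_word_def by (rule someI_ex)
  then show "some_reduced_word W I s v \<in> lists I" "wd (some_reduced_word W I s v) = v"
    "length (some_reduced_word W I s v) = len v" by (auto simp: is_reduced_word_def)
qed

lemma pi_elt_mem [simp]: "v \<in> carrier W \<Longrightarrow> pi_elt W I s v \<in> carrier M"
  by (simp add: pi_elt_def word_prod_M_mem pi_mem some_reduced_word)

lemma pi_bar_elt_mem [simp]: "v \<in> carrier W \<Longrightarrow> pi_bar_elt W I s v \<in> carrier M"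
  by (simp add: pi_bar_elt_def word_prod_M_mem pi_bar_mem some_reduced_word)

lemma pi_elt_apply:
  assumes "v \<in> carrier W" "x \<in> carrier W" "len (x \<otimes> v) = len x + len v"
  shows "pi_elt W I s v x = x \<otimes> v"
  using pi_word_apply[of "some_reduced_word W I s v" x] some_reduced_word[of v] assms
  by (simp add: pi_elt_def)

lemma pi_bar_elt_apply:
  assumes "v \<in> carrier W" "x \<in> carrier W" "len x = len (x \<otimes> v) + len v"
  shows "pi_bar_elt W I s v x = x \<otimes> v"
  using pi_bar_word_apply[of "some_reduced_word W I s v" x] some_reduced_word[of v] assms
  by (simp add: pi_bar_elt_def)

end


section \<open>The idempotents\<close>

context finite_coxeter_group
begin

abbreviation e :: "'a \<Rightarrow> 'a \<Rightarrow> 'a" where "e \<equiv> biHecke_idem W I s"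

lemma pi_elt_w0:
  assumes "v \<in> carrier W"
  shows "pi_elt W I s v w0 = w0"
proof -
  have "word_prod M (hecke_pi W I s) u w0 = w0" if "u \<in> lists I" for u
    using that
  proof (induction u)
    case (Cons i u)
    have "i \<in> I" using Cons by auto
    then have "\<not> len w0 < len (w0 \<otimes> s i)" using len_le_w0[of "w0 \<otimes> s i"] by simp
    then show ?case using Cons by (simp add: pi_apply)
  qed (simp add: one_M)
  then show ?thesis using some_reduced_word[OF assms] by (simp add: pi_elt_def)
qed

lemma e_mem [simp]: "w \<in> carrier W \<Longrightarrow> e w \<in> carrier M"
  by (simp add: biHecke_idem_def)

lemma e_apply:
  "x \<in> carrier W \<Longrightarrow> e w x = pi_bar_elt W I s (w0 \<otimes> w) (pi_elt W I s (inv w \<otimes> w0) x)"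
  by (simp add: biHecke_idem_def)

lemma e_w0:
  assumes "w \<in> carrier W"
  shows "e w w0 = w"
  using pi_bar_elt_apply[of "w0 \<otimes> w" w0] len_inv_mult_w0[OF assms] assms
  by (simp add: e_apply pi_elt_w0 len_w0_mult)

lemma e_below:
  assumes "w \<in> carrier W" "x \<in> carrier W"
  shows "left_le (e w x) w"
  using M_mono[of "e w" x w0] left_le_w0 e_w0 assms by simp

text \<open>If \<open>x\<close> is below \<open>w\<close>, then the translation of \<open>x\<close> by \<open>w\<inverse> w\<^sub>0\<close> adds lengths, because
  the one that takes \<open>w\<close> to \<open>w\<^sub>0\<close> does. So the first factor of \<open>e w\<close> translates, and the second one
  translates back.\<close>

lemma e_fixes_below:
  assumes w: "w \<in> carrier W" and x: "x \<in> carrier W" and le: "left_le x w"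
  shows "e w x = x"
proof -
  let ?v = "inv w \<otimes> w0"
  have v: "?v \<in> carrier W" "w \<otimes> ?v = w0" using w by (auto simp flip: m_assoc)
  have len: "len (x \<otimes> ?v) = len x + len ?v"
    using left_le_translate(1)[OF v(1) w x _ le] len_inv_mult_w0[OF w] v by simp
  have inv: "w0 \<otimes> w = inv ?v" using w by (simp add: inv_mult_group)
  have "x \<otimes> ?v \<otimes> (w0 \<otimes> w) = x" unfolding inv using v(1) x by (simp add: m_assoc)
  then have "pi_bar_elt W I s (w0 \<otimes> w) (x \<otimes> ?v) = x"
    using pi_bar_elt_apply[of "w0 \<otimes> w" "x \<otimes> ?v"] len w x len_w0_mult[OF w] by simp
  then show ?thesis using pi_elt_apply[OF v(1) x len] x by (simp add: e_apply)
qed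

lemma e_idempotent:
  assumes "w \<in> carrier W"
  shows "e w \<in> idempotents M"
proof -
  have "e w \<otimes>\<^bsub>M\<^esub> e w = e w"
    using assms by (intro M_eqI) (auto intro!: e_fixes_below e_below)
  then show ?thesis using assms by (simp add: idempotents_def)
qed

text \<open>A factorization of \<open>e w'\<close> through \<open>e w\<close> carries the chain \<open>\<one> \<le> w'\<close> to some \<open>p \<le> q \<le> w\<close>
  and then back. Hence \<open>w'\<close> is not longer than \<open>w\<close>; if it has the same length, then \<open>p = \<one>\<close> and
  \<open>q = w\<close>, and the last factor keeps the length of the chain, hence its labels.\<close>

lemma e_mem_ideal:
  assumes w: "w \<in> carrier W" "w' \<in> carrier W" and mem: "e w' \<in> two_sided_ideal M (e w)"
  shows "len w' \<le> len w" and "len w' = len w \<Longrightarrow> w' = w"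
proof -
  obtain c d where cd: "c \<in> carrier M" "d \<in> carrier M" "e w' = c \<otimes>\<^bsub>M\<^esub> e w \<otimes>\<^bsub>M\<^esub> d"
    using mem by (auto simp: two_sided_ideal_def)
  let ?p = "e w (c \<one>)" and ?q = "e w (c w')"
  have fixed: "e w' \<one> = \<one>" "e w' w' = w'"
    using e_fixes_below[of w' \<one>] e_fixes_below[of w' w'] left_le_one w(2)
    by (auto simp: left_le_iff)
  then have d: "d ?p = \<one>" "d ?q = w'" using cd w by auto
  have pq: "?p \<in> carrier W" "?q \<in> carrier W" using cd w by auto
  have le: "left_le ?p ?q" "left_le ?q w"
    using M_mono cd w left_le_one e_below by auto
  have len: "len w' + len ?p \<le> len ?q"
    using M_interval(1)[OF cd(2) pq le(1)] d by simp
  then show "len w' \<le> len w" using left_le_len[OF le(2)] by simp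
  assume "len w' = len w"
  then have "len ?p = 0" "len ?q = len w" using len left_le_len[OF le(2)] by auto
  then have "?p = \<one>" "?q = w"
    using len_eq_0[OF pq(1)] left_le_len_eq[OF le(2) pq(2)] by blast+
  then show "w' = w" using M_interval(2)[OF cd(2) pq le(1)] d \<open>len w' = len w\<close> w by simp
qed

text \<open>An idempotent \<open>f\<close> fixes \<open>a = f \<one>\<close> and \<open>b = f w\<^sub>0\<close>, hence the whole interval \<open>[a, b]\<close>, and
  maps into it by monotonicity. Writing \<open>b = w a\<close>, the operators \<open>\<pi>\<close> and \<open>\<pi>\<close>-bar of \<open>a\<close> and its
  inverse translate \<open>[\<one>, w]\<close>, the image of \<open>e w\<close>, to \<open>[a, b]\<close> and back.\<close>

lemma idempotent_conjugate_e:
  assumes "f \<in> idempotents M"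
  shows "\<exists>w\<in>carrier W. conjugate_idempotents M f (e w)"
proof -
  have f: "f \<in> carrier M" and "f \<otimes>\<^bsub>M\<^esub> f = f"
    using assms by (auto simp: idempotents_def)
  then have ff: "f (f x) = f x" if "x \<in> carrier W" for x
    using mult_M_apply[OF that, of f f] by simp
  let ?a = "f \<one>" and ?b = "f w0"
  define w where "w = ?b \<otimes> inv ?a"
  have a: "?a \<in> carrier W" and b: "?b \<in> carrier W" and w: "w \<in> carrier W"
    using f by (auto simp: w_def)
  have wa: "w \<otimes> ?a = ?b" using a b by (simp add: w_def m_assoc)
  have len: "len (w \<otimes> ?a) = len w + len ?a"
    using M_mono[OF f one_closed left_le_one[OF w0_closed]] a b wa by (simp add: left_le_iff w_def)
  have image: "\<exists>y\<in>carrier W. left_le y w \<and> f x = y \<otimes> ?a" if "x \<in> carrier W" for x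
    using left_le_untranslate[OF a w len] M_mono[OF f] left_le_one left_le_w0 that wa by simp
  have fix_interval: "f (y \<otimes> ?a) = y \<otimes> ?a" if "y \<in> carrier W" "left_le y w" for y
    using M_fixes_between[OF f a _ b] left_le_translate[OF a w _ len] that wa ff a by simp
  let ?P = "pi_elt W I s ?a" and ?Q = "pi_bar_elt W I s (inv ?a)"
  have PQ: "?P \<in> carrier M" "?Q \<in> carrier M" using a by auto
  have P: "?P y = y \<otimes> ?a" if "y \<in> carrier W" "left_le y w" for y
    using pi_elt_apply[OF a] left_le_translate(1)[OF a w _ len] that by simp
  have Q: "?Q (y \<otimes> ?a) = y" if "y \<in> carrier W" "left_le y w" for y
    using pi_bar_elt_apply[of "inv ?a" "y \<otimes> ?a"] left_le_translate(1)[OF a w _ len] that a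
    by (simp add: m_assoc)
  have 1: "f = (f \<otimes>\<^bsub>M\<^esub> ?Q) \<otimes>\<^bsub>M\<^esub> e w \<otimes>\<^bsub>M\<^esub> ?P"
  proof (rule M_eqI)
    fix x assume x: "x \<in> carrier W"
    then obtain y where "y \<in> carrier W" "left_le y w" "f x = y \<otimes> ?a" using image by blast
    then show "f x = ((f \<otimes>\<^bsub>M\<^esub> ?Q) \<otimes>\<^bsub>M\<^esub> e w \<otimes>\<^bsub>M\<^esub> ?P) x"
      using x P Q e_fixes_below[OF w] by simp
  qed (use f PQ w in auto)
  have 2: "e w = (e w \<otimes>\<^bsub>M\<^esub> ?P) \<otimes>\<^bsub>M\<^esub> f \<otimes>\<^bsub>M\<^esub> ?Q"
  proof (rule M_eqI)
    fix x assume "x \<in> carrier W"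
    then show "e w x = ((e w \<otimes>\<^bsub>M\<^esub> ?P) \<otimes>\<^bsub>M\<^esub> f \<otimes>\<^bsub>M\<^esub> ?Q) x"
      using P[of "e w x"] Q[of "e w x"] fix_interval[of "e w x"] e_below[OF w] w by simp
  qed (use f PQ w in auto)
  have "two_sided_ideal M f = two_sided_ideal M (e w)"
    by (rule monoid.two_sided_ideal_eqI[OF monoid_M _ _ _ _ _ _ 1 2]) (use f PQ w in auto)
  then show ?thesis using assms e_idempotent[OF w] w by (auto simp: conjugate_idempotents_def)
qed

end

theorem corollary3p12:
  fixes W :: "('a, 'b) monoid_scheme" and I :: "'i set" and s :: "'i \<Rightarrow> 'a"
  assumes "coxeter_system W I s"
    and "finite (carrier W)"
  shows "(\<forall>w\<in>carrier W. biHecke_idem W I s w \<in> idempotents (biHecke_monoid W I s)) \<and>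
    (\<forall>f\<in>idempotents (biHecke_monoid W I s).
       \<exists>!w. w \<in> carrier W \<and>
         conjugate_idempotents (biHecke_monoid W I s) f (biHecke_idem W I s w))"
proof -
  interpret group W using assms(1) by (simp add: coxeter_system_def)
  interpret finite_coxeter_group W I s by unfold_locales (use assms in auto)
  have unique: "w' = w" if w: "w \<in> carrier W" "w' \<in> carrier W"
      and eq: "two_sided_ideal M (e w) = two_sided_ideal M (e w')" for w w'
  proof -
    have "e w' \<in> two_sided_ideal M (e w)" "e w \<in> two_sided_ideal M (e w')"
      using monoid.mem_two_sided_ideal[OF monoid_M] eq w by auto
    then show ?thesis using e_mem_ideal w by (metis le_antisym)
  qed
  show ?thesis
    using e_idempotent idempotent_conjugate_e unique
    unfolding conjugate_idempotents_def by metis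
qed

end
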